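(* Let $X$ be a finite directed multigraph, $\pi=\{V_1,\dots,V_r\}$ a partition of $V(X)$, and $M\in\mathbb{C}^{V(X)\times V(X)}$ such that $(M,\pi)$ is an equitable pair. Fix $\overline v_i\in V_i$ ($i=1,\dots,r$), let $V'=V(X)\setminus\{\overline v_1,\dots,\overline v_r\}$ and $\overline P=(P,Q)$. Then $$\overline P^{-1}M\overline P=\begin{pmatrix} M/\pi & C\\ 0 & M\setminus\pi\end{pmatrix},\qquad C=M|_{\{\overline v_i\}_{i=1}^r\times V'},$$ hence $\phi(M,x)=\phi(M/\pi,x)\cdot\phi(M\setminus\pi,x)$, and $\phi(M\setminus\pi,x)$ does not depend on the choice of $\{\overline v_i\}$. In particular, if $\pi$ is an equitable partition of $X$, then $$\phi(A(X),x)=\phi(A(X/\pi),x)\cdot\phi(A(X\setminus\pi),x).$$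
   Context: $\phi(M,x)=\det(xI-M)$. $A(X)$ is the adjacency matrix ($A(X)_{uv}$ = number of edges from $u$ to $v$). $(M,\pi)$ is an equitable pair if there is $B=(b_{ij})$ with each row sum of the block $M|_{V_i\times V_j}$ equal to $b_{ij}$; $M/\pi:=B$. $\pi$ is an equitable partition if $(A(X),\pi)$ is equitable; the quotient graph $X/\pi$ has adjacency matrix $A(X/\pi)=A(X)/\pi$. $P\in\{0,1\}^{V(X)\times\pi}$: $P_{vi}=1$ iff $v\in V_i$. $Q\in\{0,1\}^{V(X)\times V'}$: $Q_{vw}=\delta_{vw}$. Deletion matrix: $M\setminus\pi\in\mathbb{C}^{V'\times V'}$, $(M\setminus\pi)_{uv}=M_{uv}-M_{\overline v_i v}$ for $u\in V_i\setminus\{\overline v_i\}$, $v\in V'$. The deletion graph $X\setminus\pi$ is the signed directed graph on $V'$ whose (integer) adjacency matrix is $A(X)\setminus\pi$ (positive entries count positive edges, negative entries count negative edges). *)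

theory Defs
  imports
    "Jordan_Normal_Form.Char_Poly"
    "Graph_Theory.Digraph"
    "HOL-Library.Disjoint_Sets"
begin

text \<open>A matrix with rows indexed by a set \<open>S\<close> and columns indexed by a set \<open>T\<close> is an entry
  function, of which only the values on \<open>S \<times> T\<close> matter. Duplicate-free lists enumerating \<open>S\<close>
  and \<open>T\<close> fix the order of the rows and columns and turn it into a matrix of type \<open>mat\<close>.\<close>

definition mat_on :: "'i list \<Rightarrow> 'j list \<Rightarrow> ('i \<Rightarrow> 'j \<Rightarrow> 'c) \<Rightarrow> 'c mat" where
  "mat_on rs cs M = mat (length rs) (length cs) (\<lambda>(i, j). M (rs ! i) (cs ! j))"

definition phi :: "'i list \<Rightarrow> ('i \<Rightarrow> 'i \<Rightarrow> complex) \<Rightarrow> complex poly" where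
  "phi vs M = char_poly (mat_on vs vs M)"

definition equitable_pair :: "'a set set \<Rightarrow> ('a \<Rightarrow> 'a \<Rightarrow> 'c::comm_monoid_add) \<Rightarrow> bool" where
  "equitable_pair \<pi> M \<longleftrightarrow>
     (\<exists>B. \<forall>V\<in>\<pi>. \<forall>W\<in>\<pi>. \<forall>u\<in>V. (\<Sum>w\<in>W. M u w) = B V W)"

text \<open>The matrix \<open>M/\<pi>\<close>, indexed by the cells. The number is unique if \<open>(M, \<pi>)\<close> is equitable,
  since cells are nonempty.\<close>

definition quotient_mat :: "'a set set \<Rightarrow> ('a \<Rightarrow> 'a \<Rightarrow> 'c::comm_monoid_add) \<Rightarrow> 'a set \<Rightarrow> 'a set \<Rightarrow> 'c" where
  "quotient_mat \<pi> M V W = (THE b. \<forall>u\<in>V. (\<Sum>w\<in>W. M u w) = b)"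

definition cell :: "'a set set \<Rightarrow> 'a \<Rightarrow> 'a set" where
  "cell \<pi> u = (THE V. V \<in> \<pi> \<and> u \<in> V)"

text \<open>The chosen vertices are given by a function \<open>rep\<close> on the cells. The set \<open>V'\<close> is then
  \<open>\<Union>\<pi> - rep ` \<pi>\<close>, and the following matrix is to be read on \<open>V' \<times> V'\<close>.\<close>

definition representatives :: "'a set set \<Rightarrow> ('a set \<Rightarrow> 'a) \<Rightarrow> bool" where
  "representatives \<pi> rep \<longleftrightarrow> (\<forall>V\<in>\<pi>. rep V \<in> V)"

definition deletion_mat ::
  "'a set set \<Rightarrow> ('a set \<Rightarrow> 'a) \<Rightarrow> ('a \<Rightarrow> 'a \<Rightarrow> 'c::minus) \<Rightarrow> 'a \<Rightarrow> 'a \<Rightarrow> 'c" where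
  "deletion_mat \<pi> rep M u v = M u v - M (rep (cell \<pi> u)) v"

definition P_mat :: "'a \<Rightarrow> 'a set \<Rightarrow> complex" where
  "P_mat v V = (if v \<in> V then 1 else 0)"

definition Q_mat :: "'a \<Rightarrow> 'a \<Rightarrow> complex" where
  "Q_mat v w = (if v = w then 1 else 0)"

text \<open>The matrix \<open>(P, Q)\<close>; the two lower blocks have no rows.\<close>

definition Pbar :: "'a list \<Rightarrow> 'a set list \<Rightarrow> 'a list \<Rightarrow> complex mat" where
  "Pbar vs ps ws =
     four_block_mat (mat_on vs ps P_mat) (mat_on vs ws Q_mat)
       (0\<^sub>m 0 (length ps)) (0\<^sub>m 0 (length ws))"

definition adj :: "('a, 'b) pre_digraph \<Rightarrow> 'a \<Rightarrow> 'a \<Rightarrow> 'c::ring_1" where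
  "adj X u v = of_nat (card {e \<in> arcs X. tail X e = u \<and> head X e = v})"

record ('a, 'b) signed_digraph = "('a, 'b) pre_digraph" +
  positive :: "'b \<Rightarrow> bool"

definition signed_adj :: "('a, 'b) signed_digraph \<Rightarrow> 'a \<Rightarrow> 'a \<Rightarrow> 'c::ring_1" where
  "signed_adj Y u v =
     of_nat (card {e \<in> arcs Y. tail Y e = u \<and> head Y e = v \<and> positive Y e}) -
     of_nat (card {e \<in> arcs Y. tail Y e = u \<and> head Y e = v \<and> \<not> positive Y e})"

definition equitable_partition :: "('a, 'b) pre_digraph \<Rightarrow> 'a set set \<Rightarrow> bool" where
  "equitable_partition X \<pi> \<longleftrightarrow>
     partition_on (verts X) \<pi> \<and> equitable_pair \<pi> (adj X :: 'a \<Rightarrow> 'a \<Rightarrow> complex)"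

text \<open>In the quotient graph and the deletion graph, an arc is a triple of its tail, its head and
  a number distinguishing it from the arcs parallel to it.\<close>

definition quotient_graph ::
  "('a, 'b) pre_digraph \<Rightarrow> 'a set set \<Rightarrow> ('a set, 'a set \<times> 'a set \<times> nat) pre_digraph" where
  "quotient_graph X \<pi> =
     \<lparr>verts = \<pi>,
      arcs = {(V, W, k). V \<in> \<pi> \<and> W \<in> \<pi> \<and> int k < quotient_mat \<pi> (adj X) V W},
      tail = (\<lambda>(V, W, k). V),
      head = (\<lambda>(V, W, k). W)\<rparr>"

definition deletion_graph ::
  "('a, 'b) pre_digraph \<Rightarrow> 'a set set \<Rightarrow> ('a set \<Rightarrow> 'a) \<Rightarrow> ('a, 'a \<times> 'a \<times> nat) signed_digraph" where
  "deletion_graph X \<pi> rep =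
     \<lparr>verts = verts X - rep ` \<pi>,
      arcs = {(u, v, k). u \<in> verts X - rep ` \<pi> \<and> v \<in> verts X - rep ` \<pi> \<and>
                         int k < \<bar>deletion_mat \<pi> rep (adj X) u v\<bar>},
      tail = (\<lambda>(u, v, k). u),
      head = (\<lambda>(u, v, k). v),
      positive = (\<lambda>(u, v, k). (0::int) < deletion_mat \<pi> rep (adj X) u v)\<rparr>"

text \<open>The quotient graph and the deletion graph are well formed and have the adjacency matrices
  \<open>A(X)/\<pi>\<close> and \<open>A(X) \<setminus> \<pi>\<close>.\<close>

lemma quotient_mat_eq:
  assumes "equitable_pair \<pi> M" "V \<in> \<pi>" "W \<in> \<pi>" "u \<in> V"
  shows "quotient_mat \<pi> M V W = (\<Sum>w\<in>W. M u w)"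
  unfolding quotient_mat_def
proof (rule the_equality)
  show "\<forall>u'\<in>V. (\<Sum>w\<in>W. M u' w) = (\<Sum>w\<in>W. M u w)"
    using assms unfolding equitable_pair_def by metis
next
  fix b assume "\<forall>u'\<in>V. (\<Sum>w\<in>W. M u' w) = b"
  then show "b = (\<Sum>w\<in>W. M u w)" using assms(4) by simp
qed

lemma cell_eq:
  assumes "partition_on A \<pi>" "V \<in> \<pi>" "u \<in> V"
  shows "cell \<pi> u = V"
  unfolding cell_def
proof (rule the_equality)
  fix W assume "W \<in> \<pi> \<and> u \<in> W"
  then show "W = V" using assms unfolding partition_on_def disjoint_def by blast
qed (use assms in simp)

lemma of_int_adj: "of_int (adj X u v) = adj X u v"
  by (simp add: adj_def)

lemma equitable_pair_adj_int:
  assumes "equitable_partition X \<pi>"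
  shows "equitable_pair \<pi> (adj X :: _ \<Rightarrow> _ \<Rightarrow> int)"
proof -
  obtain B :: "'a set \<Rightarrow> 'a set \<Rightarrow> complex"
    where B: "\<forall>V\<in>\<pi>. \<forall>W\<in>\<pi>. \<forall>u\<in>V. (\<Sum>w\<in>W. adj X u w) = B V W"
    using assms unfolding equitable_partition_def equitable_pair_def by blast
  have eq: "(\<Sum>w\<in>W. adj X u w :: int) = \<lfloor>Re (B V W)\<rfloor>"
    if "V \<in> \<pi>" "W \<in> \<pi>" "u \<in> V" for V W u
  proof -
    have "B V W = of_int (\<Sum>w\<in>W. adj X u w)"
      using B that by (simp add: of_int_adj)
    then show ?thesis by (simp del: of_int_sum)
  qed
  show ?thesis unfolding equitable_pair_def
    by (rule exI[of _ "\<lambda>V W. \<lfloor>Re (B V W)\<rfloor>"]) (use eq in blast)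
qed

lemma fin_digraph_quotient_graph:
  assumes "fin_digraph X" "partition_on (verts X) \<pi>"
  shows "fin_digraph (quotient_graph X \<pi>)"
proof -
  have fin: "finite \<pi>"
    using assms finite_elements fin_digraph.finite_verts by blast
  have "arcs (quotient_graph X \<pi>) \<subseteq>
      (\<Union>V\<in>\<pi>. \<Union>W\<in>\<pi>. {V} \<times> {W} \<times> {..<nat (quotient_mat \<pi> (adj X) V W)})"
    by (auto simp: quotient_graph_def)
  moreover have "finite (\<Union>V\<in>\<pi>. \<Union>W\<in>\<pi>. {V} \<times> {W} \<times> {..<nat (quotient_mat \<pi> (adj X) V W)})"
    using fin by blast
  ultimately have "finite (arcs (quotient_graph X \<pi>))"
    by (rule finite_subset)
  then show ?thesis
    using fin by unfold_locales (auto simp: quotient_graph_def)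
qed

lemma adj_quotient_graph:
  assumes "equitable_partition X \<pi>" "V \<in> \<pi>" "W \<in> \<pi>"
  shows "adj (quotient_graph X \<pi>) V W = (quotient_mat \<pi> (adj X) V W :: complex)"
proof -
  have "V \<noteq> {}"
    using assms unfolding equitable_partition_def partition_on_def by blast
  then obtain u where u: "u \<in> V" by blast
  define b :: int where "b = (\<Sum>w\<in>W. adj X u w)"
  have b0: "b \<ge> 0" unfolding b_def by (rule sum_nonneg) (simp add: adj_def)
  have q1: "quotient_mat \<pi> (adj X) V W = b"
    unfolding b_def using assms u by (intro quotient_mat_eq equitable_pair_adj_int)
  have q2: "quotient_mat \<pi> (adj X) V W = (of_int b :: complex)"
    using quotient_mat_eq[of \<pi> "adj X :: _ \<Rightarrow> _ \<Rightarrow> complex" V W u] assms u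
    by (simp add: b_def of_int_adj equitable_partition_def)
  have "{e \<in> arcs (quotient_graph X \<pi>). tail (quotient_graph X \<pi>) e = V
      \<and> head (quotient_graph X \<pi>) e = W} = (\<lambda>k. (V, W, k)) ` {..<nat b}"
    using assms b0 by (auto simp: quotient_graph_def q1)
  then have "card {e \<in> arcs (quotient_graph X \<pi>). tail (quotient_graph X \<pi>) e = V
      \<and> head (quotient_graph X \<pi>) e = W} = nat b"
    by (simp add: card_image inj_on_def)
  then show ?thesis using b0 by (simp add: adj_def[of "quotient_graph X \<pi>"] q2)
qed

lemma fin_digraph_deletion_graph:
  assumes "fin_digraph X"
  shows "fin_digraph (pre_digraph.truncate (deletion_graph X \<pi> rep))"
proof -
  let ?V = "verts X - rep ` \<pi>"
  let ?D = "deletion_mat \<pi> rep (adj X) :: _ \<Rightarrow> _ \<Rightarrow> int"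
  have fin: "finite ?V"
    using assms fin_digraph.finite_verts by blast
  have "arcs (deletion_graph X \<pi> rep) \<subseteq> (\<Union>u\<in>?V. \<Union>v\<in>?V. {u} \<times> {v} \<times> {..<nat \<bar>?D u v\<bar>})"
    by (auto simp: deletion_graph_def)
  moreover have "finite (\<Union>u\<in>?V. \<Union>v\<in>?V. {u} \<times> {v} \<times> {..<nat \<bar>?D u v\<bar>})"
    using fin by blast
  ultimately have "finite (arcs (deletion_graph X \<pi> rep))"
    by (rule finite_subset)
  then show ?thesis
    using fin by unfold_locales (auto simp: deletion_graph_def pre_digraph.truncate_def)
qed

lemma signed_adj_deletion_graph:
  assumes "u \<in> verts X - rep ` \<pi>" "v \<in> verts X - rep ` \<pi>"
  shows "signed_adj (deletion_graph X \<pi> rep) u v = (deletion_mat \<pi> rep (adj X) u v :: complex)"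
proof -
  define d :: int where "d = deletion_mat \<pi> rep (adj X) u v"
  let ?Y = "deletion_graph X \<pi> rep"
  have d: "deletion_mat \<pi> rep (adj X) u v = (of_int d :: complex)"
    by (simp add: d_def deletion_mat_def of_int_adj)
  have p: "{e \<in> arcs ?Y. tail ?Y e = u \<and> head ?Y e = v \<and> positive ?Y e}
      = (\<lambda>k. (u, v, k)) ` {..<nat d}"
    using assms by (auto simp: deletion_graph_def d_def)
  have n: "{e \<in> arcs ?Y. tail ?Y e = u \<and> head ?Y e = v \<and> \<not> positive ?Y e}
      = (\<lambda>k. (u, v, k)) ` {..<nat (- d)}"
    using assms by (auto simp: deletion_graph_def d_def)
  have "card ((\<lambda>k. (u, v, k)) ` {..<m}) = m" for m :: nat
    by (simp add: card_image inj_on_def)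
  then show ?thesis unfolding signed_adj_def p n d
    by (cases "d \<ge> 0") simp_all
qed

end

theory Submission
  imports Defs
begin

text \<open>The columns of \<open>(P, Q)\<close> and the rows and columns of the block triangular matrix \<open>D\<close> are
  indexed by the disjoint sum of the cells and \<open>V'\<close>. The conjugation identity
  \<open>M (P, Q) = (P, Q) D\<close> is checked entrywise: equitability gives the columns of the cells, and in the
  column of \<open>w \<in> V'\<close> the product \<open>P C\<close> restores the entry \<open>M (rep V) w\<close> that is subtracted in
  \<open>M \<setminus> \<pi>\<close>. The independence of the representatives follows by cancelling the monic
  polynomial of the quotient.\<close>

section \<open>Matrices indexed by lists, their products and blocks\<close>

lemma mat_on_carrier [simp]: "mat_on rs cs M \<in> carrier_mat (length rs) (length cs)"
  by (simp add: mat_on_def)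

lemma mat_on_cong:
  assumes "\<And>i j. i \<in> set rs \<Longrightarrow> j \<in> set cs \<Longrightarrow> M i j = N i j"
  shows "mat_on rs cs M = mat_on rs cs N"
  using assms by (auto simp: mat_on_def)

text \<open>Distinctness makes \<open>(!) ks\<close> a bijection from positions to
  \<open>set ks\<close>, so the scalar product over positions becomes a sum over a set, where no
  order of the indices is left.\<close>

lemma mat_on_mult:
  assumes "distinct ks"
  shows "mat_on rs ks M * mat_on ks cs N = mat_on rs cs (\<lambda>i j. \<Sum>k\<in>set ks. M i k * N k j)"
proof (rule eq_matI)
  fix i j assume "i < dim_row (mat_on rs cs (\<lambda>i j. \<Sum>k\<in>set ks. M i k * N k j))"
    and "j < dim_col (mat_on rs cs (\<lambda>i j. \<Sum>k\<in>set ks. M i k * N k j))"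
  moreover have "bij_betw ((!) ks) {0..<length ks} (set ks)"
    using assms by (simp add: bij_betw_nth atLeast0LessThan)
  ultimately show "(mat_on rs ks M * mat_on ks cs N) $$ (i, j)
      = mat_on rs cs (\<lambda>i j. \<Sum>k\<in>set ks. M i k * N k j) $$ (i, j)"
    by (simp add: mat_on_def scalar_prod_def
        sum.reindex_bij_betw[of "(!) ks" _ _ "\<lambda>k. M (rs ! i) k * N k (cs ! j)", symmetric])
qed (simp_all add: mat_on_def)

lemma mat_on_delta:
  assumes "distinct xs"
  shows "mat_on xs xs (\<lambda>i j. if i = j then 1 else 0) = 1\<^sub>m (length xs)"
  using assms by (auto simp: mat_on_def nth_eq_iff_index_eq)

text \<open>Presents a block matrix as one matrix over a sum type, so that
  \<open>mat_on_mult\<close> covers all blocks at once.\<close>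

lemma four_block_mat_on:
  "four_block_mat (mat_on rs cs A) (mat_on rs cs' B) (mat_on rs' cs C) (mat_on rs' cs' D)
    = mat_on (map Inl rs @ map Inr rs') (map Inl cs @ map Inr cs')
        (\<lambda>i j. case i of
            Inl r \<Rightarrow> (case j of Inl c \<Rightarrow> A r c | Inr c \<Rightarrow> B r c)
          | Inr r \<Rightarrow> (case j of Inl c \<Rightarrow> C r c | Inr c \<Rightarrow> D r c))"
  by (rule eq_matI) (auto simp: mat_on_def nth_append)

lemma mat_on_map: "mat_on (map f rs) cs M = mat_on rs cs (\<lambda>i. M (f i))"
  by (auto simp: mat_on_def)

lemma zero_mat_on: "0\<^sub>m (length rs) (length cs) = mat_on rs cs (\<lambda>i j. 0)"
  by (auto simp: mat_on_def)

text \<open>The two lower blocks of \<open>Pbar\<close> have no rows, so only the columns are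
  indexed by a sum.\<close>

lemma Pbar_eq_mat_on:
  "Pbar vs ps ws = mat_on vs (map Inl ps @ map Inr ws) (\<lambda>v. case_sum (P_mat v) (Q_mat v))"
  unfolding Pbar_def by (rule eq_matI) (auto simp: mat_on_def nth_append)

section \<open>Characteristic polynomials\<close>

lemma phi_cong:
  assumes "\<And>i j. i \<in> set vs \<Longrightarrow> j \<in> set vs \<Longrightarrow> M i j = N i j"
  shows "phi vs M = phi vs N"
  unfolding phi_def using mat_on_cong[of vs vs M N] assms by simp

lemma phi_nonzero: "phi vs M \<noteq> 0"
  unfolding phi_def using degree_monic_char_poly[OF mat_on_carrier, of vs M] by auto

text \<open>Subtracting from x times the identity keeps the lower left block zero and puts the
  characteristic matrices of \<open>A\<close> and \<open>D\<close> on the diagonal; the determinant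
  then splits.\<close>

lemma char_poly_four_block_lower_left_zero:
  fixes A :: "'c :: idom mat"
  assumes A: "A \<in> carrier_mat n n" and B: "B \<in> carrier_mat n m" and D: "D \<in> carrier_mat m m"
  shows "char_poly (four_block_mat A B (0\<^sub>m m n) D) = char_poly A * char_poly D"
proof -
  have "char_poly_matrix (four_block_mat A B (0\<^sub>m m n) D) =
      four_block_mat (char_poly_matrix A) (map_mat (\<lambda>a. [:- a:]) B) (0\<^sub>m m n) (char_poly_matrix D)"
    using assms by (intro eq_matI) (auto simp: char_poly_matrix_def)
  moreover have "char_poly_matrix A \<in> carrier_mat n n" "char_poly_matrix D \<in> carrier_mat m m"
    using A D by simp_all
  ultimately show ?thesis
    using B by (simp add: char_poly_def det_four_block_mat_lower_left_zero)
qed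

section \<open>Cells, representatives and cardinalities\<close>

context
  fixes S :: "'a set" and \<pi> :: "'a set set" and rep :: "'a set \<Rightarrow> 'a"
    and vs ws :: "'a list" and ps :: "'a set list"
  assumes part: "partition_on S \<pi>" and rep: "representatives \<pi> rep"
    and vs: "distinct vs" "set vs = S"
    and ps: "distinct ps" "set ps = \<pi>"
    and ws: "distinct ws" "set ws = S - rep ` \<pi>"
begin

lemma rep_in_cell: "V \<in> \<pi> \<Longrightarrow> rep V \<in> V"
  using rep by (simp add: representatives_def)

lemma cell_in_partition: "v \<in> S \<Longrightarrow> cell \<pi> v \<in> \<pi> \<and> v \<in> cell \<pi> v"
  using cell_eq[OF part] part by (metis UnionE partition_on_def)

lemma mem_cell_iff: "V \<in> \<pi> \<Longrightarrow> v \<in> V \<longleftrightarrow> v \<in> S \<and> cell \<pi> v = V"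
  using cell_eq[OF part, of V v] cell_in_partition part
  by (metis Union_upper partition_on_def subsetD)

lemma cell_rep: "V \<in> \<pi> \<Longrightarrow> cell \<pi> (rep V) = V"
  using mem_cell_iff rep_in_cell by blast

lemma rep_in_carrier: "V \<in> \<pi> \<Longrightarrow> rep V \<in> S"
  using mem_cell_iff rep_in_cell by blast

lemma finite_index: "finite S" "finite \<pi>"
  using vs ps by auto

text \<open>Distinct cells have distinct representatives, so V' is smaller than \<open>S\<close> by
  the number of cells. This makes (P, Q) square.\<close>

lemma length_index: "length vs = length ps + length ws"
proof -
  have "inj_on rep \<pi>" by (metis cell_rep inj_onI)
  then have "card (rep ` \<pi>) = length ps"
    using ps by (simp add: card_image distinct_card[symmetric])
  moreover have "rep ` \<pi> \<subseteq> S" using rep_in_carrier by blast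
  moreover have "card S = length vs" "card (S - rep ` \<pi>) = length ws"
    using vs ws distinct_card by metis+
  ultimately show ?thesis
    using finite_index card_mono[of S "rep ` \<pi>"] by (simp add: card_Diff_subset)
qed

section \<open>The sum index and the inverse of (P, Q)\<close>

lemma distinct_sum_index: "distinct (map Inl ps @ map Inr ws)"
  using ps ws by (auto simp: distinct_map)

lemma set_sum_index: "set (map Inl ps @ map Inr ws) = \<pi> <+> (S - rep ` \<pi>)"
  using ps ws by auto

text \<open>The explicit inverse of (P, Q), found by solving x = P a + Q b: at \<open>rep V\<close>
  only the column of \<open>V\<close> is nonzero, so a at \<open>V\<close> is x at
  \<open>rep V\<close>; at \<open>w\<close> in V' the value of a at the cell of \<open>w\<close> has
  to be subtracted from x at \<open>w\<close> to obtain b.\<close>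

definition Rbar :: "complex mat" where
  "Rbar = mat_on (map Inl ps @ map Inr ws) vs
     (\<lambda>i v. case i of Inl V \<Rightarrow> Q_mat (rep V) v
                     | Inr w \<Rightarrow> Q_mat w v - Q_mat (rep (cell \<pi> w)) v)"

lemma sum_Q_mat: "u \<in> S \<Longrightarrow> (\<Sum>v\<in>S. Q_mat u v * f v) = f u"
  unfolding Q_mat_def using finite_index
  by (simp add: if_distrib[of "\<lambda>x. x * _"] cong: if_cong)

text \<open>Each vertex lies in exactly one cell, so a row of P selects a single term.\<close>

lemma sum_P_mat: "v \<in> S \<Longrightarrow> (\<Sum>V\<in>\<pi>. P_mat v V * f V) = f (cell \<pi> v)"
proof -
  assume v: "v \<in> S"
  have "(\<Sum>V\<in>\<pi>. P_mat v V * f V) = (\<Sum>V\<in>\<pi>. if cell \<pi> v = V then f V else 0)"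
    using v by (intro sum.cong) (auto simp: P_mat_def mem_cell_iff)
  also have "\<dots> = f (cell \<pi> v)"
    using cell_in_partition[OF v] finite_index by simp
  finally show ?thesis .
qed

lemma Rbar_carrier: "Rbar \<in> carrier_mat (length vs) (length vs)"
  unfolding Rbar_def using mat_on_carrier[of "map Inl ps @ map Inr ws" vs]
  by (simp add: length_index)

lemma Pbar_carrier: "Pbar vs ps ws \<in> carrier_mat (length vs) (length vs)"
  unfolding Pbar_eq_mat_on using mat_on_carrier[of vs "map Inl ps @ map Inr ws"]
  by (simp add: length_index)

lemma Rbar_mult_Pbar: "Rbar * Pbar vs ps ws = 1\<^sub>m (length vs)"
proof -
  have "(\<Sum>v\<in>S. (case i of Inl V \<Rightarrow> Q_mat (rep V) v | Inr w \<Rightarrow> Q_mat w v - Q_mat (rep (cell \<pi> w)) v)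
        * case_sum (P_mat v) (Q_mat v) j) = (if i = j then 1 else 0)"
    if "i \<in> \<pi> <+> (S - rep ` \<pi>)" "j \<in> \<pi> <+> (S - rep ` \<pi>)" for i j
  proof (cases i)
    case (Inl V)
    with that have V: "V \<in> \<pi>" by auto
    show ?thesis
    proof (cases j)
      case W: (Inl W)
      with that have "rep V \<in> W \<longleftrightarrow> V = W"
        using V by (auto simp: mem_cell_iff rep_in_carrier cell_rep)
      then show ?thesis
        using Inl W V by (simp add: sum_Q_mat rep_in_carrier P_mat_def)
    next
      case w: (Inr w)
      \<comment> \<open>V' contains no representative, so a column of Q vanishes at all of
        them.\<close>
      with that have "rep V \<noteq> w" using V by auto
      then show ?thesis
        using Inl w V by (simp add: sum_Q_mat rep_in_carrier Q_mat_def[of "rep V" w])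
    qed
  next
    case (Inr u)
    with that have u: "u \<in> S" "cell \<pi> u \<in> \<pi>" using cell_in_partition by auto
    have diff: "(\<Sum>v\<in>S. (Q_mat u v - Q_mat (rep (cell \<pi> u)) v) * f v) = f u - f (rep (cell \<pi> u))" for f
      using u by (simp add: left_diff_distrib sum_subtractf sum_Q_mat rep_in_carrier)
    show ?thesis
    proof (cases j)
      case W: (Inl W)
      \<comment> \<open>A vertex and the representative of its cell lie in the same cells, so the
        two entries of P cancel.\<close>
      with that have "rep (cell \<pi> u) \<in> W \<longleftrightarrow> u \<in> W"
        using u by (auto simp: mem_cell_iff rep_in_carrier cell_rep)
      then show ?thesis
        using Inr W by (simp add: diff P_mat_def)
    next
      case w: (Inr w)
      with that have "rep (cell \<pi> u) \<noteq> w" using u by auto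
      then show ?thesis
        using Inr w by (simp add: diff Q_mat_def[of _ w])
    qed
  qed
  then have "Rbar * Pbar vs ps ws = 1\<^sub>m (length (map Inl ps @ map Inr ws :: ('a set + 'a) list))"
    unfolding Rbar_def Pbar_eq_mat_on mat_on_mult[OF vs(1)]
      mat_on_delta[OF distinct_sum_index, symmetric]
    by (intro mat_on_cong) (simp add: vs(2) flip: set_sum_index)
  then show ?thesis by (simp add: length_index)
qed

section \<open>Conjugation to block triangular form\<close>

lemma mult_Pbar_eq:
  assumes M: "equitable_pair \<pi> M"
  shows "mat_on vs vs M * Pbar vs ps ws =
    Pbar vs ps ws * four_block_mat
      (mat_on ps ps (quotient_mat \<pi> M))
      (mat_on (map rep ps) ws M)
      (0\<^sub>m (length ws) (length ps))
      (mat_on ws ws (deletion_mat \<pi> rep M))"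
  unfolding zero_mat_on mat_on_map four_block_mat_on Pbar_eq_mat_on mat_on_mult[OF vs(1)]
    mat_on_mult[OF distinct_sum_index]
proof (intro mat_on_cong, unfold vs(2) set_sum_index)
  fix v and j :: "'a set + 'a"
  assume v: "v \<in> S" and j: "j \<in> \<pi> <+> (S - rep ` \<pi>)"
  let ?D = "\<lambda>i. case i of
            Inl r \<Rightarrow> (case j of Inl c \<Rightarrow> quotient_mat \<pi> M r c | Inr c \<Rightarrow> M (rep r) c)
          | Inr r \<Rightarrow> (case j of Inl c \<Rightarrow> 0 | Inr c \<Rightarrow> deletion_mat \<pi> rep M r c)"
  have "(\<Sum>k\<in>\<pi> <+> (S - rep ` \<pi>). case_sum (P_mat v) (Q_mat v) k * ?D k)
      = ?D (Inl (cell \<pi> v)) + (\<Sum>w\<in>S - rep ` \<pi>. Q_mat v w * ?D (Inr w))"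
    using finite_index v by (subst sum.Plus) (auto simp: sum_P_mat)
  \<comment> \<open>The row of Q at a representative is zero; any other row has a single 1, at
    \<open>v\<close> itself.\<close>
  also have "(\<Sum>w\<in>S - rep ` \<pi>. Q_mat v w * ?D (Inr w)) = (if v \<in> rep ` \<pi> then 0 else ?D (Inr v))"
    unfolding Q_mat_def using finite_index v
    by (simp add: if_distrib[of "\<lambda>x. x * _"] cong: if_cong)
  also have "?D (Inl (cell \<pi> v)) + \<dots> = (\<Sum>u\<in>S. M v u * case_sum (P_mat u) (Q_mat u) j)"
  proof (cases j)
    case (Inl W)
    then have W: "W \<in> \<pi>" using j by auto
    then have "W \<subseteq> S" using mem_cell_iff by blast
    have "(\<Sum>u\<in>S. M v u * P_mat u W) = (\<Sum>u\<in>W. M v u)"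
      using \<open>W \<subseteq> S\<close> finite_index
      by (simp add: P_mat_def sum.If_cases if_distrib Int_absorb1 cong: if_cong)
    \<comment> \<open>The lower left block is zero, so only the quotient entry for the cell of
      \<open>v\<close> remains; as \<open>v\<close> lies in that cell, this entry is the row sum at
      \<open>v\<close>.\<close>
    then show ?thesis
      using Inl quotient_mat_eq[OF M _ W] cell_in_partition[OF v] by simp
  next
    case (Inr w)
    have "(\<Sum>u\<in>S. M v u * Q_mat u w) = M v w"
      using j Inr finite_index by (auto simp: Q_mat_def if_distrib cong: if_cong)
    \<comment> \<open>If \<open>v\<close> represents its cell, its row of C is already its row of M;
      otherwise that row of C cancels the term subtracted in \<open>deletion_mat\<close>.\<close>
    then show ?thesis
      using Inr by (auto simp: deletion_mat_def cell_rep)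
  qed
  finally show "(\<Sum>u\<in>S. M v u * case_sum (P_mat u) (Q_mat u) j) =
      (\<Sum>k\<in>\<pi> <+> (S - rep ` \<pi>). case_sum (P_mat v) (Q_mat v) k * ?D k)" by simp
qed

lemma Rbar_conjugation:
  assumes "equitable_pair \<pi> M"
  shows "Rbar * mat_on vs vs M * Pbar vs ps ws =
    four_block_mat
      (mat_on ps ps (quotient_mat \<pi> M))
      (mat_on (map rep ps) ws M)
      (0\<^sub>m (length ws) (length ps))
      (mat_on ws ws (deletion_mat \<pi> rep M))" (is "_ = ?D")
proof -
  have D: "?D \<in> carrier_mat (length vs) (length vs)"
    unfolding length_index by (intro four_block_carrier_mat) auto
  have "Rbar * mat_on vs vs M * Pbar vs ps ws = Rbar * (mat_on vs vs M * Pbar vs ps ws)"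
    using assoc_mult_mat[OF Rbar_carrier mat_on_carrier Pbar_carrier] .
  also have "\<dots> = Rbar * Pbar vs ps ws * ?D"
    using assoc_mult_mat[OF Rbar_carrier Pbar_carrier D] mult_Pbar_eq[OF assms] by simp
  finally show ?thesis
    using left_mult_one_mat[OF D] by (simp only: Rbar_mult_Pbar)
qed

text \<open>A left inverse of a square matrix is two-sided.\<close>

lemma Pbar_mult_Rbar: "Pbar vs ps ws * Rbar = 1\<^sub>m (length vs)"
  using mat_mult_left_right_inverse[OF Rbar_carrier Pbar_carrier Rbar_mult_Pbar] .

lemma block_triangularization:
  assumes "equitable_pair \<pi> M"
  shows "\<exists>R. inverts_mat (Pbar vs ps ws) R \<and> inverts_mat R (Pbar vs ps ws) \<and>
     R * mat_on vs vs M * Pbar vs ps ws =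
       four_block_mat
         (mat_on ps ps (quotient_mat \<pi> M))
         (mat_on (map rep ps) ws M)
         (0\<^sub>m (length ws) (length ps))
         (mat_on ws ws (deletion_mat \<pi> rep M))"
  using Rbar_conjugation[OF assms] Rbar_mult_Pbar Pbar_mult_Rbar Rbar_carrier Pbar_carrier
  by (intro exI[of _ Rbar]) (simp add: inverts_mat_def)

section \<open>Factorization of the characteristic polynomial\<close>

lemma phi_factorization:
  assumes "equitable_pair \<pi> M"
  shows "phi vs M = phi ps (quotient_mat \<pi> M) * phi ws (deletion_mat \<pi> rep M)"
proof -
  let ?D = "Rbar * mat_on vs vs M * Pbar vs ps ws"
  have "similar_mat ?D (mat_on vs vs M)"
    using Rbar_carrier Pbar_carrier Rbar_mult_Pbar Pbar_mult_Rbar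
    by (intro similar_matI[of _ _ Rbar "Pbar vs ps ws" "length vs"]) auto
  then have "phi vs M = char_poly ?D"
    by (simp add: phi_def char_poly_similar)
  then show ?thesis
    unfolding Rbar_conjugation[OF assms] phi_def
    using mat_on_carrier[of "map rep ps" ws M]
    by (simp add: char_poly_four_block_lower_left_zero[of _ "length ps" _ "length ws"])
qed

end

section \<open>Independence of the representatives, and adjacency matrices\<close>

theorem theorem4p4:
  fixes X :: "('a, 'b) pre_digraph" and \<pi> :: "'a set set" and rep :: "'a set \<Rightarrow> 'a"
    and vs :: "'a list" and ps :: "'a set list" and ws :: "'a list"
  assumes "fin_digraph X"
    and "partition_on (verts X) \<pi>"
    and "representatives \<pi> rep"
    and "distinct vs" and "set vs = verts X"
    and "distinct ps" and "set ps = \<pi>"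
    and "distinct ws" and "set ws = verts X - rep ` \<pi>"
  shows
    "(\<forall>M :: 'a \<Rightarrow> 'a \<Rightarrow> complex. equitable_pair \<pi> M \<longrightarrow>
        (\<exists>R. inverts_mat (Pbar vs ps ws) R \<and> inverts_mat R (Pbar vs ps ws) \<and>
             R * mat_on vs vs M * Pbar vs ps ws =
               four_block_mat
                 (mat_on ps ps (quotient_mat \<pi> M))
                 (mat_on (map rep ps) ws M)
                 (0\<^sub>m (length ws) (length ps))
                 (mat_on ws ws (deletion_mat \<pi> rep M))) \<and>
        phi vs M = phi ps (quotient_mat \<pi> M) * phi ws (deletion_mat \<pi> rep M) \<and>
        (\<forall>rep' ws'. representatives \<pi> rep' \<and>
             distinct ws' \<and> set ws' = verts X - rep' ` \<pi> \<longrightarrow>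
             phi ws' (deletion_mat \<pi> rep' M) = phi ws (deletion_mat \<pi> rep M))) \<and>
     (equitable_partition X \<pi> \<longrightarrow>
        phi vs (adj X) =
          phi ps (adj (quotient_graph X \<pi>)) * phi ws (signed_adj (deletion_graph X \<pi> rep)))"
proof (intro conjI allI impI)
  note part = assms(2) and vs = assms(4,5) and ps = assms(6,7)
  \<comment> \<open>The representatives and the enumeration of V' stay open, so that the fact serves
    both choices.\<close>
  note factor = phi_factorization[OF part _ vs ps]
  fix M :: "'a \<Rightarrow> 'a \<Rightarrow> complex" assume M: "equitable_pair \<pi> M"
  show "\<exists>R. inverts_mat (Pbar vs ps ws) R \<and> inverts_mat R (Pbar vs ps ws) \<and>
     R * mat_on vs vs M * Pbar vs ps ws =
       four_block_mat
         (mat_on ps ps (quotient_mat \<pi> M))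
         (mat_on (map rep ps) ws M)
         (0\<^sub>m (length ws) (length ps))
         (mat_on ws ws (deletion_mat \<pi> rep M))"
    using block_triangularization[OF assms(2-9) M] .
  show *: "phi vs M = phi ps (quotient_mat \<pi> M) * phi ws (deletion_mat \<pi> rep M)"
    using factor[OF assms(3,8,9) M] .
  fix rep' ws'
  assume "representatives \<pi> rep' \<and> distinct ws' \<and> set ws' = verts X - rep' ` \<pi>"
  then have "phi vs M = phi ps (quotient_mat \<pi> M) * phi ws' (deletion_mat \<pi> rep' M)"
    using factor M by blast
  \<comment> \<open>Both factorizations share the quotient factor, which is nonzero and can be
    cancelled.\<close>
  then show "phi ws' (deletion_mat \<pi> rep' M) = phi ws (deletion_mat \<pi> rep M)"
    using * phi_nonzero[of ps "quotient_mat \<pi> M"] by simp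
next
  assume X: "equitable_partition X \<pi>"
  then have "phi vs (adj X) = phi ps (quotient_mat \<pi> (adj X)) * phi ws (deletion_mat \<pi> rep (adj X))"
    by (intro phi_factorization[OF assms(2-9)]) (simp add: equitable_partition_def)
  \<comment> \<open>The adjacency matrices of the two derived graphs are compared with the quotient
    and deletion matrices on the index sets only, hence \<open>phi_cong\<close>.\<close>
  moreover have "phi ps (quotient_mat \<pi> (adj X)) = phi ps (adj (quotient_graph X \<pi>))"
    using X assms(7) by (intro phi_cong) (simp add: adj_quotient_graph)
  moreover have "phi ws (deletion_mat \<pi> rep (adj X)) = phi ws (signed_adj (deletion_graph X \<pi> rep))"
    using assms(9) by (intro phi_cong) (simp add: signed_adj_deletion_graph)
  ultimately show "phi vs (adj X) =
      phi ps (adj (quotient_graph X \<pi>)) * phi ws (signed_adj (deletion_graph X \<pi> rep))"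
    by simp
qed

end
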